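(* Let $d\ge 1$, $I^d=[0,1]^d$, let $u:I^d\to\mathbb{R}$, and for every mesh vector $\mathbf{h}=(h_1,\dots,h_d)$ whose entries are powers $h_j=2^{-l_j}$, $l_j\in\mathbb{N}_0$, let $u_{\mathbf{h}}:I^d\to\mathbb{R}$ be an approximation of $u$. Assume there exist functions $\beta_j\in L^\infty(I^d\times[0,1]^{d-1})$ for $1\le j\le d$ and $\gamma_{j_1,\dots,j_m}\in L^\infty(I^d\times[0,1]^m)$ for every $1\le m\le d$ and every subset $\{j_1,\dots,j_m\}\subset\{1,\dots,d\}$ of size $m$, with $\|\gamma_{j_1,\dots,j_m}\|_\infty\le K$, such that $$u-u_{\mathbf{h}}=\sum_{j=1}^d \beta_j(\cdot;h_1,\dots,h_{j-1},h_{j+1},\dots,h_d)\,h_j^2+\sum_{m=1}^d\ \sum_{\{j_1,\dots,j_m\}\subset\{1,\dots,d\}}\gamma_{j_1,\dots,j_m}(\cdot;h_{j_1},\dots,h_{j_m})\,h_{j_1}^4\cdots h_{j_m}^4$$ for all such $\mathbf{h}$. Then the extrapolated solution $\tilde u_{\mathbf{h}}$ (defined in the context) satisfies, for all such $\mathbf{h}$, $$u-\tilde u_{\mathbf{h}}=\sum_{m=1}^d\ \sum_{\{j_1,\dots,j_m\}\subset\{1,\dots,d\}}\tilde\gamma_{j_1,\dots,j_m}(\cdot;h_{j_1},\dots,h_{j_m})\,h_{j_1}^4\cdots h_{j_m}^4$$ for some functions $\tilde\gamma_{j_1,\dots,j_m}$ with $\|\tilde\gamma_{j_1,\dots,j_m}\|_\infty\le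 \frac{5^d}{3^d}K$.
   Context: In the application, $u_{\mathbf{h}}$ is the piecewise multilinear interpolant of a finite difference solution on the tensor product grid with mesh sizes $\mathbf{h}$; only the stated expansion is used as a hypothesis. Extrapolated solution: $$\tilde u_{\mathbf{h}}=\sum_{k=0}^d\alpha_k\sum_{\{i_1,\dots,i_k\}\subset\{1,\dots,d\}}u_{\mathbf{h}}^{(i_1,\dots,i_k)},\qquad \alpha_k=\frac{(-4)^k}{(-3)^d},$$ where the inner sum runs over subsets of size $k$, and $u_{\mathbf{h}}^{(i_1,\dots,i_k)}:=u_{\mathbf{h}'}$ with $h'_j=h_j/2$ if $j\in\{i_1,\dots,i_k\}$ and $h'_j=h_j$ otherwise. Since the functions are evaluated at individual points and individual mesh sizes, $L^\infty(X)$ means the space of bounded real functions on $X$ and $\|\cdot\|_\infty$ is the supremum norm; identities between functions on $I^d$ hold pointwise. *)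

theory Defs
  imports "HOL-Analysis.Analysis"
begin

text \<open>
  Coordinates are indexed by subsets \<open>J\<close> of \<open>{1..d}\<close>: a point of \<open>[0,1]\<^sup>J\<close> is an extensional
  function on \<open>J\<close>. So \<open>I\<^sup>d\<close> is \<open>cube {1..d}\<close>, and the argument
  \<open>(h\<^sub>j)\<close>, \<open>j \<in> J = {j\<^sub>1,\<dots>,j\<^sub>m}\<close>, of \<open>\<gamma>\<close> ranges over \<open>cube J\<close>, the cube \<open>[0,1]\<^sup>m\<close> with
  coordinates labelled by the elements of \<open>J\<close> (no ordering of \<open>J\<close> has to be chosen).
\<close>

definition cube :: "nat set \<Rightarrow> (nat \<Rightarrow> real) set" where
  "cube J = J \<rightarrow>\<^sub>E {0..1}"

definition meshes :: "nat \<Rightarrow> (nat \<Rightarrow> real) set" where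
  "meshes d = {1..d} \<rightarrow>\<^sub>E {1 / 2 ^ l |l::nat. True}"

text \<open>
  Functions are evaluated pointwise, so these are genuine bounded functions with the supremum
  norm, not classes modulo null sets. Only values on \<open>X\<close> matter.
\<close>

definition Linf :: "'a set \<Rightarrow> ('a \<Rightarrow> real) set" where
  "Linf X = {f. bounded (f ` X)}"

definition sup_norm :: "'a set \<Rightarrow> ('a \<Rightarrow> real) \<Rightarrow> real" where
  "sup_norm X f = (SUP x\<in>X. \<bar>f x\<bar>)"

definition halve :: "nat set \<Rightarrow> (nat \<Rightarrow> real) \<Rightarrow> nat \<Rightarrow> real" where
  "halve S h = (\<lambda>j. if j \<in> S then h j / 2 else h j)"

definition extrap_coeff :: "nat \<Rightarrow> nat \<Rightarrow> real" where
  "extrap_coeff d k = (-4) ^ k / (-3) ^ d"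

definition extrapolated ::
  "nat \<Rightarrow> ((nat \<Rightarrow> real) \<Rightarrow> 'x \<Rightarrow> real) \<Rightarrow> (nat \<Rightarrow> real) \<Rightarrow> 'x \<Rightarrow> real" where
  "extrapolated d uh h x =
     (\<Sum>k=0..d. extrap_coeff d k * (\<Sum>S | S \<subseteq> {1..d} \<and> card S = k. uh (halve S h) x))"

end

theory Submission
  imports Defs
begin

text \<open>
  The weights \<open>(-4)\<^bsup>|S|\<^esup> / (-3)\<^sup>d\<close> sum to \<open>1\<close> over all \<open>S \<subseteq> {1..d}\<close>, so \<open>u\<close> minus the
  extrapolated solution is the weighted sum of the errors on the refined grids. In the
  \<open>\<beta>\<^sub>j\<close>-term the contributions of \<open>S\<close> and \<open>S \<union> {j}\<close> cancel: the weight is multiplied by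
  \<open>-4\<close> and \<open>h\<^sub>j\<^sup>2\<close> by \<open>1/4\<close>. The \<open>\<gamma>\<^sub>J\<close>-terms are collected, and the bound
  follows from \<open>\<Sum>\<^sub>S 4\<^bsup>|S|\<^esup> / 3\<^sup>d = 5\<^sup>d / 3\<^sup>d\<close>.
\<close>

text \<open>Expanding the product of \<open>c + 1\<close> over \<open>A\<close> chooses
  \<open>c\<close> or \<open>1\<close> for each element, and \<open>S\<close> records where
  \<open>c\<close> is chosen.\<close>

lemma sum_Pow_power_card:
  fixes c :: "'a::comm_semiring_1"
  assumes "finite A"
  shows "(\<Sum>S\<in>Pow A. c ^ card S) = (1 + c) ^ card A"
  using prod_add[OF assms, of "\<lambda>_. c" "\<lambda>_. 1"] by (simp add: add.commute)

lemma sum_by_card: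
  assumes "finite A"
  shows "(\<Sum>k=0..card A. \<Sum>S | S \<subseteq> A \<and> card S = k. f S) = (\<Sum>S\<in>Pow A. f S)"
proof -
  have "(\<Sum>k\<in>{0..card A}. \<Sum>S | S \<in> Pow A \<and> card S = k. f S) = (\<Sum>S\<in>Pow A. f S)"
    using assms by (intro sum.group) (auto intro: card_mono)
  then show ?thesis by simp
qed

text \<open>A single sum over all subsets can be exchanged with other sums and split into pairs,
  which the grouping by cardinality would obstruct.\<close>

lemma extrapolated_eq_sum_Pow:
  "extrapolated d uh h x = (\<Sum>S\<in>Pow {1..d}. extrap_coeff d (card S) * uh (halve S h) x)"
proof -
  have "extrapolated d uh h x
      = (\<Sum>k=0..d. \<Sum>S | S \<subseteq> {1..d} \<and> card S = k. extrap_coeff d (card S) * uh (halve S h) x)"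
    unfolding extrapolated_def by (intro sum.cong refl) (simp add: sum_distrib_left)
  then show ?thesis using sum_by_card[OF finite_atLeastAtMost[of 1 d]]
    by (simp only: card_atLeastAtMost diff_Suc_1)
qed

text \<open>The numerators sum to \<open>(1 - 4) ^ d\<close>, which explains the normalisation by
  \<open>(-3) ^ d\<close>.\<close>

lemma sum_extrap_coeff: "(\<Sum>S\<in>Pow {1..d}. extrap_coeff d (card S)) = 1"
  using sum_Pow_power_card[of "{1..d}" "-4::real"]
  by (simp add: extrap_coeff_def sum_divide_distrib[symmetric])

lemma sum_abs_extrap_coeff: "(\<Sum>S\<in>Pow {1..d}. \<bar>extrap_coeff d (card S)\<bar>) = 5 ^ d / 3 ^ d"
  using sum_Pow_power_card[of "{1..d}" "4::real"]
  by (simp add: extrap_coeff_def abs_divide power_abs sum_divide_distrib[symmetric])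

text \<open>The subsets of \<open>A\<close> split into those avoiding \<open>a\<close> and those
  containing it, and \<open>insert a\<close> is a bijection from the first kind to the
  second.\<close>

lemma sum_Pow_eq_0_if_insert_cancels:
  fixes f :: "'a set \<Rightarrow> 'b::ab_group_add"
  assumes "finite A" "a \<in> A"
    and cancel: "\<And>S. S \<subseteq> A - {a} \<Longrightarrow> f S + f (insert a S) = 0"
  shows "(\<Sum>S\<in>Pow A. f S) = 0"
proof -
  have "Pow A = Pow (A - {a}) \<union> insert a ` Pow (A - {a})"
    using Pow_insert[of a "A - {a}"] assms(2) by (simp add: insert_absorb)
  then have "(\<Sum>S\<in>Pow A. f S)
      = (\<Sum>S\<in>Pow (A - {a}). f S) + (\<Sum>S\<in>insert a ` Pow (A - {a}). f S)"
    using assms(1) by (simp only:) (intro sum.union_disjoint, auto)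
  also have "(\<Sum>S\<in>insert a ` Pow (A - {a}). f S) = (\<Sum>S\<in>Pow (A - {a}). f (insert a S))"
    by (subst sum.reindex) (auto simp: inj_on_def)
  finally show ?thesis using cancel by (simp add: sum.distrib[symmetric])
qed

text \<open>This makes the error expansion available on every refined grid.\<close>

lemma halve_in_meshes:
  assumes "h \<in> meshes d" "S \<subseteq> {1..d}"
  shows "halve S h \<in> meshes d"
proof -
  have "h j / 2 \<in> {1 / 2 ^ l |l::nat. True}" if j: "j \<in> {1..d}" for j
  proof -
    obtain l :: nat where "h j = 1 / 2 ^ l"
      using assms(1) j unfolding meshes_def PiE_iff by blast
    then have "h j / 2 = 1 / 2 ^ Suc l" by simp
    then show ?thesis by blast
  qed
  \<comment> \<open>Since \<open>S \<subseteq> {1..d}\<close>, the value \<open>undefined\<close>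
    outside \<open>{1..d}\<close> is not halved, so \<open>halve S h\<close> stays
    extensional.\<close>
  then show ?thesis
    using assms unfolding meshes_def halve_def PiE_iff extensional_def by auto
qed

text \<open>Here \<open>S\<close> need not lie in \<open>J\<close>, so halving may disturb the
  default value outside \<open>J\<close>; \<open>restrict\<close> resets it.\<close>

lemma restrict_halve_in_cube:
  assumes "g \<in> cube J"
  shows "restrict (halve S g) J \<in> cube J"
proof -
  have "0 \<le> g j" "g j \<le> 1" if "j \<in> J" for j
    using assms that by (auto simp: cube_def PiE_iff)
  then show ?thesis
    unfolding cube_def PiE_iff by (fastforce simp: halve_def)
qed

lemma cube_nonempty: "cube J \<noteq> {}"
  by (auto simp: cube_def PiE_eq_empty_iff)

lemma abs_le_sup_norm:
  assumes "f \<in> Linf X" "x \<in> X"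
  shows "\<bar>f x\<bar> \<le> sup_norm X f"
proof -
  obtain B where "\<forall>x\<in>X. \<bar>f x\<bar> \<le> B"
    using assms(1) by (auto simp: Linf_def bounded_iff)
  \<comment> \<open>A real \<open>SUP\<close> is known to dominate its members only for a set that
    is bounded above, which membership in \<open>Linf\<close> supplies.\<close>
  then have "bdd_above ((\<lambda>x. \<bar>f x\<bar>) ` X)" by (auto intro: bdd_aboveI2)
  then show ?thesis using assms(2) unfolding sup_norm_def by (rule cSUP_upper2) simp_all
qed

text \<open>
  All \<open>S \<subseteq> {1..d}\<close> are summed over, although the summand depends on \<open>S\<close> only through \<open>S \<inter> J\<close>
  apart from the weight; summing out \<open>S - J\<close> would give the sharper bound \<open>(5/12)\<^bsup>|J|\<^esup> K\<close>.
\<close>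

definition extrap_gamma ::
  "nat \<Rightarrow> (nat set \<Rightarrow> 'x \<times> (nat \<Rightarrow> real) \<Rightarrow> real) \<Rightarrow> nat set \<Rightarrow> 'x \<times> (nat \<Rightarrow> real) \<Rightarrow> real" where
  "extrap_gamma d \<gamma> J = (\<lambda>(x, g). \<Sum>S\<in>Pow {1..d}. extrap_coeff d (card S) *
     (\<gamma> J (x, restrict (halve S g) J) * (1 / 16) ^ card (J \<inter> S)))"

lemma abs_extrap_gamma_le:
  assumes bound: "\<And>g. g \<in> cube J \<Longrightarrow> \<bar>\<gamma> J (x, g)\<bar> \<le> K" and "g \<in> cube J"
  shows "\<bar>extrap_gamma d \<gamma> J (x, g)\<bar> \<le> 5 ^ d / 3 ^ d * K"
proof -
  \<comment> \<open>The power of \<open>1 / 16\<close> is at most 1 and is simply dropped.\<close>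
  have le: "\<bar>\<gamma> J (x, restrict (halve S g) J) * (1 / 16) ^ card (J \<inter> S)\<bar> \<le> K" for S
  proof -
    have "\<bar>\<gamma> J (x, restrict (halve S g) J)\<bar> * (1 / 16) ^ card (J \<inter> S)
        \<le> \<bar>\<gamma> J (x, restrict (halve S g) J)\<bar>"
      by (intro mult_right_le_one_le power_le_one) auto
    also have "\<dots> \<le> K" using bound restrict_halve_in_cube[OF assms(2)] by blast
    finally show ?thesis by (simp add: abs_mult)
  qed
  have "\<bar>extrap_gamma d \<gamma> J (x, g)\<bar> \<le> (\<Sum>S\<in>Pow {1..d}. \<bar>extrap_coeff d (card S)\<bar> * K)"
    unfolding extrap_gamma_def prod.case
    by (intro order_trans[OF sum_abs] sum_mono)
      (simp only: abs_mult[of "extrap_coeff _ _"] le mult_left_mono abs_ge_zero)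
  then show ?thesis
    by (simp only: sum_distrib_right[symmetric] sum_abs_extrap_coeff)
qed

text \<open>Each halved coordinate in \<open>J\<close> contributes
  \<open>(1 / 2) ^ 4 = 1 / 16\<close>; this is the source of the powers in
  \<open>extrap_gamma\<close>.\<close>

lemma prod_halve_power4:
  assumes "finite J"
  shows "(\<Prod>j\<in>J. halve S h j ^ 4) = (1 / 16) ^ card (J \<inter> S) * (\<Prod>j\<in>J. h j ^ 4)"
proof -
  have "(\<Prod>j\<in>J. halve S h j ^ 4) = (\<Prod>j\<in>J. (if j \<in> S then 1 / 16 else 1) * h j ^ 4)"
    by (intro prod.cong) (auto simp: halve_def power_divide)
  also have "\<dots> = (\<Prod>j\<in>J. if j \<in> S then 1 / 16 else 1) * (\<Prod>j\<in>J. h j ^ 4)"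
    by (rule prod.distrib)
  also have "(\<Prod>j\<in>J. if j \<in> S then 1 / 16 else 1 :: real) = (1 / 16) ^ card (J \<inter> S)"
    using assms by (simp add: prod.inter_restrict[symmetric])
  finally show ?thesis .
qed

text \<open>The argument of \<open>b\<close> omits coordinate \<open>j\<close>, so \<open>b\<close>
  takes the same value for \<open>S\<close> and \<open>insert j S\<close>. Only the weight and the
  square change, by the factors \<open>-4\<close> and \<open>1 / 4\<close>.\<close>

lemma beta_terms_cancel:
  assumes j: "j \<in> {1..d}"
  shows "(\<Sum>S\<in>Pow {1..d}. extrap_coeff d (card S) *
           (b (restrict (halve S h) ({1..d} - {j})) * halve S h j ^ 2)) = 0"
proof (rule sum_Pow_eq_0_if_insert_cancels[OF _ j])
  fix S assume S: "S \<subseteq> {1..d} - {j}"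
  then have "finite S" "j \<notin> S" by (auto intro: finite_subset)
  then have "extrap_coeff d (card (insert j S)) = -4 * extrap_coeff d (card S)"
    by (simp add: extrap_coeff_def)
  moreover have "restrict (halve (insert j S) h) ({1..d} - {j}) = restrict (halve S h) ({1..d} - {j})"
    by (auto simp: restrict_def halve_def)
  moreover have "halve (insert j S) h j = h j / 2" "halve S h j = h j"
    using \<open>j \<notin> S\<close> by (auto simp: halve_def)
  ultimately show "extrap_coeff d (card S) *
        (b (restrict (halve S h) ({1..d} - {j})) * halve S h j ^ 2) +
      extrap_coeff d (card (insert j S)) *
        (b (restrict (halve (insert j S) h) ({1..d} - {j})) * halve (insert j S) h j ^ 2) = 0"
    by (simp only: power_divide) simp
qed simp

lemma gamma_terms_collect:
  assumes "finite J"
  shows "(\<Sum>S\<in>Pow {1..d}. extrap_coeff d (card S) *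
           (\<gamma> J (x, restrict (halve S h) J) * (\<Prod>j\<in>J. halve S h j ^ 4)))
       = extrap_gamma d \<gamma> J (x, restrict h J) * (\<Prod>j\<in>J. h j ^ 4)"
proof -
  \<comment> \<open>\<open>extrap_gamma\<close> sees only \<open>restrict h J\<close>, but this
    determines the halved mesh on \<open>J\<close>.\<close>
  have "restrict (halve S (restrict h J)) J = restrict (halve S h) J" for S
    by (auto simp: restrict_def halve_def)
  then show ?thesis
    unfolding extrap_gamma_def prod.case sum_distrib_right prod_halve_power4[OF assms]
    by (simp add: mult.assoc)
qed

theorem theorem2p4:
  fixes d :: nat
    and u :: "(nat \<Rightarrow> real) \<Rightarrow> real"
    and uh :: "(nat \<Rightarrow> real) \<Rightarrow> (nat \<Rightarrow> real) \<Rightarrow> real"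
    and \<beta> :: "nat \<Rightarrow> (nat \<Rightarrow> real) \<times> (nat \<Rightarrow> real) \<Rightarrow> real"
    and \<gamma> :: "nat set \<Rightarrow> (nat \<Rightarrow> real) \<times> (nat \<Rightarrow> real) \<Rightarrow> real"
    and K :: real
  assumes "d \<ge> 1"
    and "\<And>j. j \<in> {1..d} \<Longrightarrow> \<beta> j \<in> Linf (cube {1..d} \<times> cube ({1..d} - {j}))"
    and "\<And>m J. m \<in> {1..d} \<Longrightarrow> J \<subseteq> {1..d} \<Longrightarrow> card J = m \<Longrightarrow>
           \<gamma> J \<in> Linf (cube {1..d} \<times> cube J) \<and> sup_norm (cube {1..d} \<times> cube J) (\<gamma> J) \<le> K"
    and "\<And>h x. h \<in> meshes d \<Longrightarrow> x \<in> cube {1..d} \<Longrightarrow>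
           u x - uh h x =
             (\<Sum>j=1..d. \<beta> j (x, restrict h ({1..d} - {j})) * h j ^ 2) +
             (\<Sum>m=1..d. \<Sum>J | J \<subseteq> {1..d} \<and> card J = m.
                \<gamma> J (x, restrict h J) * (\<Prod>j\<in>J. h j ^ 4))"
  shows "\<exists>\<gamma>' :: nat set \<Rightarrow> (nat \<Rightarrow> real) \<times> (nat \<Rightarrow> real) \<Rightarrow> real.
           (\<forall>m\<in>{1..d}. \<forall>J. J \<subseteq> {1..d} \<and> card J = m \<longrightarrow>
              \<gamma>' J \<in> Linf (cube {1..d} \<times> cube J) \<and>
              sup_norm (cube {1..d} \<times> cube J) (\<gamma>' J) \<le> 5 ^ d / 3 ^ d * K) \<and>
           (\<forall>h\<in>meshes d. \<forall>x\<in>cube {1..d}.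
              u x - extrapolated d uh h x =
                (\<Sum>m=1..d. \<Sum>J | J \<subseteq> {1..d} \<and> card J = m.
                   \<gamma>' J (x, restrict h J) * (\<Prod>j\<in>J. h j ^ 4)))"
proof -
  define \<gamma>' where "\<gamma>' = extrap_gamma d \<gamma>"
  have "\<gamma>' J \<in> Linf (cube {1..d} \<times> cube J) \<and>
      sup_norm (cube {1..d} \<times> cube J) (\<gamma>' J) \<le> 5 ^ d / 3 ^ d * K"
    if "m \<in> {1..d}" "J \<subseteq> {1..d}" "card J = m" for m J
  proof -
    let ?X = "cube {1..d} \<times> cube J"
    have gamma_le: "\<bar>\<gamma> J z\<bar> \<le> K" if "z \<in> ?X" for z
      using abs_le_sup_norm[of "\<gamma> J" ?X z] assms(3)[OF \<open>m \<in> {1..d}\<close> \<open>J \<subseteq> {1..d}\<close> \<open>card J = m\<close>] that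
      by linarith
    then have bound: "\<bar>\<gamma>' J z\<bar> \<le> 5 ^ d / 3 ^ d * K" if "z \<in> ?X" for z
    proof -
      obtain x g where z: "z = (x, g)" "x \<in> cube {1..d}" "g \<in> cube J"
        using \<open>z \<in> ?X\<close> by (rule SigmaE)
      then show ?thesis
        unfolding \<gamma>'_def z(1) by (intro abs_extrap_gamma_le gamma_le SigmaI)
    qed
    \<comment> \<open>\<open>cSUP_least\<close> bounds a supremum only over a nonempty set.\<close>
    have "?X \<noteq> {}" using cube_nonempty by simp
    then have "sup_norm ?X (\<gamma>' J) \<le> 5 ^ d / 3 ^ d * K"
      unfolding sup_norm_def using bound by (rule cSUP_least)
    moreover have "\<gamma>' J \<in> Linf ?X"
      unfolding Linf_def mem_Collect_eq
      by (rule boundedI[of _ "5 ^ d / 3 ^ d * K"], erule imageE) (simp only: real_norm_def bound)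
    ultimately show ?thesis by blast
  qed
  moreover have "u x - extrapolated d uh h x =
      (\<Sum>m=1..d. \<Sum>J | J \<subseteq> {1..d} \<and> card J = m. \<gamma>' J (x, restrict h J) * (\<Prod>j\<in>J. h j ^ 4))"
    if h: "h \<in> meshes d" and x: "x \<in> cube {1..d}" for h x
  proof -
    let ?c = "\<lambda>S. extrap_coeff d (card S)"
    let ?B = "\<lambda>S j. \<beta> j (x, restrict (halve S h) ({1..d} - {j})) * halve S h j ^ 2"
    let ?G = "\<lambda>S J. \<gamma> J (x, restrict (halve S h) J) * (\<Prod>j\<in>J. halve S h j ^ 4)"
    have "u x - extrapolated d uh h x
        = (\<Sum>S\<in>Pow {1..d}. ?c S) * u x - (\<Sum>S\<in>Pow {1..d}. ?c S * uh (halve S h) x)"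
      by (simp only: extrapolated_eq_sum_Pow sum_extrap_coeff mult_1)
    also have "\<dots> = (\<Sum>S\<in>Pow {1..d}. ?c S * (u x - uh (halve S h) x))"
      by (simp only: sum_distrib_right sum_subtractf[symmetric] right_diff_distrib)
    \<comment> \<open>The assumed expansion is applied at the mesh \<open>halve S h\<close> for each
      \<open>S\<close>.\<close>
    also have "\<dots> = (\<Sum>S\<in>Pow {1..d}. ?c S *
        ((\<Sum>j=1..d. ?B S j) + (\<Sum>m=1..d. \<Sum>J | J \<subseteq> {1..d} \<and> card J = m. ?G S J)))"
      using halve_in_meshes[OF h] x by (intro sum.cong refl) (simp only: assms(4) Pow_iff)
    also have "\<dots> = (\<Sum>S\<in>Pow {1..d}. \<Sum>j=1..d. ?c S * ?B S j) +
        (\<Sum>S\<in>Pow {1..d}. \<Sum>m=1..d. \<Sum>J | J \<subseteq> {1..d} \<and> card J = m. ?c S * ?G S J)"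
      by (simp only: distrib_left sum.distrib sum_distrib_left)
    also have "(\<Sum>S\<in>Pow {1..d}. \<Sum>j=1..d. ?c S * ?B S j) = (\<Sum>j=1..d. 0)"
      by (subst sum.swap) (intro sum.cong refl beta_terms_cancel)
    \<comment> \<open>The range of \<open>J\<close> depends on \<open>m\<close>, so the sum over
      \<open>S\<close> moves inward in two separate exchanges.\<close>
    also have "(\<Sum>S\<in>Pow {1..d}. \<Sum>m=1..d. \<Sum>J | J \<subseteq> {1..d} \<and> card J = m. ?c S * ?G S J)
        = (\<Sum>m=1..d. \<Sum>S\<in>Pow {1..d}. \<Sum>J | J \<subseteq> {1..d} \<and> card J = m. ?c S * ?G S J)"
      by (rule sum.swap)
    also have "\<dots> = (\<Sum>m=1..d. \<Sum>J | J \<subseteq> {1..d} \<and> card J = m. \<Sum>S\<in>Pow {1..d}. ?c S * ?G S J)"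
      by (rule sum.cong[OF refl]) (rule sum.swap)
    also have "\<dots> = (\<Sum>m=1..d. \<Sum>J | J \<subseteq> {1..d} \<and> card J = m.
        \<gamma>' J (x, restrict h J) * (\<Prod>j\<in>J. h j ^ 4))"
      unfolding \<gamma>'_def
      by (intro sum.cong refl gamma_terms_collect) (auto intro: finite_subset)
    finally show ?thesis by simp
  qed
  ultimately show ?thesis by blast
qed

end
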